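(* For every $\varepsilon>0$ and every real $\rho>1$ there exist an integer $n$, a finite set $W\subset\{1,\rho,\rho^2,\dots\}$, and a probability distribution $D$ over the $n$-element subsets of $W$ such that, if an instance of the single secretary problem is drawn from $D$, every randomized algorithm (which may know $D$) accepts the maximum element of the instance with probability at most $\frac1e+\varepsilon$, the probability being over the choice of the instance, the uniformly random arrival order, and the algorithm's randomness.
   Context: Single secretary problem with $n$ items: an instance is a set of $n$ pairwise distinct positive reals presented one at a time in uniformly random order; the algorithm must irrevocably accept or reject each element upon arrival and may accept at most one. A randomized algorithm is given by probabilities $a_i(v_1,\dots,v_i)\in[0,1]$ of stopping and accepting $v_i$ at time $i$ given the sequence seen so far and not having stopped earlier. *)

theory Defs
  imports "HOL-Probability.Probability" "HOL-Combinatorics.Multiset_Permutations"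
begin

text \<open>A randomized online algorithm for the single secretary problem is given by a
function a, where a(v_1,...,v_i) is the probability of stopping and accepting v_i at
time i, given the sequence seen so far and not having stopped earlier (the time i is
the length of the list).\<close>

definition valid_algorithm :: "(real list \<Rightarrow> real) \<Rightarrow> bool" where
  "valid_algorithm a \<longleftrightarrow> (\<forall>xs. 0 \<le> a xs \<and> a xs \<le> 1)"

definition accept_prob :: "(real list \<Rightarrow> real) \<Rightarrow> real list \<Rightarrow> nat \<Rightarrow> real" where
  "accept_prob a xs i = (\<Prod>j<i. 1 - a (take (Suc j) xs)) * a (take (Suc i) xs)"

definition success_prob :: "(real list \<Rightarrow> real) \<Rightarrow> real list \<Rightarrow> real" where
  "success_prob a xs = (\<Sum>i<length xs. if xs ! i = Max (set xs) then accept_prob a xs i else 0)"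

definition instance_success :: "(real list \<Rightarrow> real) \<Rightarrow> real set \<Rightarrow> real" where
  "instance_success a S =
     measure_pmf.expectation (pmf_of_set (permutations_of_set S)) (success_prob a)"

end

theory Submission
  imports Defs
begin

text \<open>The instance is Gnedin's construction in discrete form: the exponents form an $n$-subset
$K$ of $\{1,\dots,N\}$ with weight proportional to $1/(\max K)_n$, where $(m)_n$ is the falling
factorial. Without the cutoff $N$, the weight of a prefix of length $i$ with maximum $m$ would be
exactly proportional to $1/(i\,(m)_i)$, because these weights telescope. Hence the values carry no
information beyond relative ranks: the next element is a record with probability $1/(i+1)$, and a
record at time $i$ is the overall maximum with probability $i/n$. The cutoff only helps as far as
these upper bounds are concerned, so backward induction bounds the unnormalised success weight by
the value of the classical secretary recursion times $H_N$, while the normalising constant is at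
least $H_N - H_n$.\<close>

section \<open>Falling factorials and the telescoping weights\<close>

definition falling :: "nat \<Rightarrow> nat \<Rightarrow> real" where
  "falling k m = (\<Prod>j<k. real m - real j)"

lemma falling_0 [simp]: "falling 0 m = 1"
  by (simp add: falling_def)

lemma falling_Suc: "falling (Suc k) m = falling k m * (real m - real k)"
  by (simp add: falling_def)

lemma falling_Suc_Suc: "falling (Suc k) (Suc m) = (real m + 1) * falling k m"
  unfolding falling_def by (subst prod.lessThan_Suc_shift) (simp add: add.commute)

lemma falling_pos: "k \<le> m \<Longrightarrow> 0 < falling k m"
  unfolding falling_def by (rule prod_pos) auto

lemma falling_nonneg: "0 \<le> falling k m"
proof (cases "k \<le> m")
  case False
  then have "\<exists>j\<in>{..<k}. real m - real j = 0" by (intro bexI[of _ m]) auto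
  then have "falling k m = 0" unfolding falling_def by (subst prod_zero_iff) auto
  then show ?thesis by simp
qed (use falling_pos[of k m] in simp)

lemma falling_add: "i \<le> m \<Longrightarrow> falling (i + k) m = falling i m * falling k (m - i)"
  by (induction k) (simp_all add: falling_Suc of_nat_diff algebra_simps)

lemma falling_self: "falling n n = fact n"
  by (induction n) (simp_all add: falling_Suc_Suc)

lemma falling_eq_binomial: "falling k m = fact k * real (m choose k)"
proof (cases "k \<le> m")
  case True
  then show ?thesis
    using falling_add[OF True, of "m - k"] binomial_fact[OF True, where 'a=real]
    by (simp add: falling_self field_simps)
next
  case False
  then have "falling k m = 0" unfolding falling_def by (subst prod_zero_iff) auto
  then show ?thesis using False by simp
qed

text \<open>Unnormalised probability of a given arrival prefix of length $i$ with maximum $m$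
  (without the cutoff).\<close>

definition weight :: "nat \<Rightarrow> nat \<Rightarrow> real" where
  "weight i m = 1 / (real i * falling i m)"

lemma weight_nonneg: "0 \<le> weight i m"
  by (simp add: weight_def falling_nonneg)

text \<open>Eliminating \<open>falling i m\<close> through
  \<open>falling i (Suc m) * (m + 1 - i) = (m + 1) * falling i m\<close> leaves an identity of
  rational functions. Read as a difference in \<open>m\<close>, it makes the weights of record
  extensions a telescoping sum.\<close>

lemma weight_telescope:
  assumes "0 < i" "i \<le> m"
  shows "weight i m = weight i (Suc m) + (real i + 1) * weight (Suc i) (Suc m)"
proof -
  have p: "falling i m > 0" "real i > 0" using assms falling_pos by auto
  have p2: "falling i (Suc m) > 0" using assms falling_pos by auto
  have p3: "real m + 1 - real i > 0" using assms by linarith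
  have e: "falling i (Suc m) * (real m + 1 - real i) = (real m + 1) * falling i m"
    using falling_Suc[of i "Suc m"] falling_Suc_Suc[of i m] by (simp add: add.commute)
  then have e': "falling i m = falling i (Suc m) * (real m + 1 - real i) / (real m + 1)"
    by (simp add: field_simps)
  show ?thesis
    unfolding weight_def falling_Suc_Suc e' using p p2 p3
    by (simp add: divide_simps) (simp add: algebra_simps)
qed

text \<open>The records that can follow a prefix with maximum \<open>m\<close> are the values above
  \<open>m\<close>, and their weights telescope to a fraction \<open>1 / (i + 1)\<close> of the
  prefix weight. The cutoff \<open>N\<close> leaves a negative boundary term, which is dropped; this
  is the only loss caused by the cutoff.\<close>

lemma sum_weight_record_le:
  assumes "0 < i" "i \<le> m"
  shows "(\<Sum>x\<in>{m<..N}. weight (Suc i) x) \<le> weight i m / (real i + 1)"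
proof (cases "m \<le> N")
  case True
  have "(\<Sum>x\<in>{m<..N}. weight (Suc i) x) = (weight i m - weight i N) / (real i + 1)"
    using True
  proof (induction N rule: dec_induct)
    case (step N)
    have "{m<..Suc N} = insert (Suc N) {m<..N}" using step by auto
    then have "(\<Sum>x\<in>{m<..Suc N}. weight (Suc i) x) = weight (Suc i) (Suc N) + (weight i m - weight i N) / (real i + 1)"
      using step by simp
    also have "\<dots> = (weight i m - weight i (Suc N)) / (real i + 1)"
      using weight_telescope[of i N] step assms by (simp add: field_simps)
    finally show ?case .
  qed simp
  also have "\<dots> \<le> weight i m / (real i + 1)"
    by (intro divide_right_mono) (simp_all add: weight_nonneg)
  finally show ?thesis .
qed (simp add: weight_nonneg)

section \<open>Enumeration of sequences without repetition\<close>

definition distinct_lists :: "'a set \<Rightarrow> nat \<Rightarrow> 'a list set" where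
  "distinct_lists A k = {xs. length xs = k \<and> distinct xs \<and> set xs \<subseteq> A}"

lemma distinct_lists_0 [simp]: "distinct_lists A 0 = {[]}"
  by (auto simp: distinct_lists_def)

lemma finite_distinct_lists: "finite A \<Longrightarrow> finite (distinct_lists A k)"
  unfolding distinct_lists_def
  by (rule finite_subset[OF _ finite_lists_length_eq[of A k]]) auto

lemma sum_distinct_lists_Suc:
  fixes g :: "'a list \<Rightarrow> real"
  assumes "finite A"
  shows "(\<Sum>xs\<in>distinct_lists A (Suc k). g xs) =
         (\<Sum>x\<in>A. \<Sum>z\<in>distinct_lists (A - {x}) k. g (x # z))"
proof -
  have "(\<Sum>x\<in>A. \<Sum>z\<in>distinct_lists (A - {x}) k. g (x # z)) =
        (\<Sum>(x, z)\<in>(SIGMA x:A. distinct_lists (A - {x}) k). g (x # z))"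
    by (rule sum.Sigma) (auto simp: assms finite_distinct_lists)
  also have "\<dots> = (\<Sum>xs\<in>distinct_lists A (Suc k). g xs)"
    by (rule sum.reindex_bij_witness[where j = "\<lambda>(x, z). x # z" and i = "\<lambda>xs. (hd xs, tl xs)"])
      (auto simp: distinct_lists_def length_Suc_conv)
  finally show ?thesis ..
qed

lemma card_distinct_lists:
  assumes "finite A"
  shows "real (card (distinct_lists A k)) = falling k (card A)"
  using assms
proof (induction k arbitrary: A)
  case (Suc k)
  have "real (card (distinct_lists A (Suc k))) = (\<Sum>xs\<in>distinct_lists A (Suc k). 1)"
    by simp
  also have "\<dots> = (\<Sum>x\<in>A. real (card (distinct_lists (A - {x}) k)))"
    using Suc.prems by (subst sum_distinct_lists_Suc) simp_all
  also have "\<dots> = (\<Sum>x\<in>A. falling k (card A - 1))"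
    using Suc by (intro sum.cong) auto
  also have "\<dots> = falling (Suc k) (card A)"
  proof (cases "card A")
    case 0
    then show ?thesis by (simp add: falling_def prod.lessThan_Suc_shift del: prod.lessThan_Suc)
  qed (simp add: falling_Suc_Suc add.commute)
  finally show ?case .
qed simp

section \<open>Backward induction on the success weight\<close>

text \<open>This is the conditional success probability when \<open>p\<close> has been seen without
  stopping and \<open>z\<close> is still to come. The target \<open>M\<close> is a separate argument
  because the maximum of the whole sequence is unknown from \<open>p\<close> alone; the recursion on
  \<open>z\<close> matches one decision of the algorithm.\<close>

fun gain :: "('a list \<Rightarrow> real) \<Rightarrow> 'a list \<Rightarrow> 'a \<Rightarrow> 'a list \<Rightarrow> real" where
  "gain a p M [] = 0"
| "gain a p M (x # z) =
     a (p @ [x]) * (if x = M then 1 else 0) + (1 - a (p @ [x])) * gain a (p @ [x]) M z"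

text \<open>For \<open>p = []\<close> the right side has the shape of \<open>success_prob\<close>,
  so this links the recursive form to the given model.\<close>

lemma gain_eq_sum:
  "gain a p M z = (\<Sum>i<length z. if z ! i = M
     then (\<Prod>j<i. 1 - a (p @ take (Suc j) z)) * a (p @ take (Suc i) z) else 0)"
proof (induction z arbitrary: p)
  case (Cons x z)
  show ?case
    by (simp only: gain.simps Cons.IH list.size sum.lessThan_Suc_shift add_Suc_right add_0_right
          prod.lessThan_Suc_shift sum_distrib_left o_def)
      (auto intro!: sum.cong simp: mult.assoc)
qed simp

text \<open>This is the payoff of accepting \<open>x\<close>. A non-record never wins. A record wins
  exactly when the tail uses only unseen values below \<open>x\<close>; there are
  \<open>falling k (x - Suc (length p))\<close> such tails, and this factor cancels against
  \<open>falling n x\<close>.\<close>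

lemma win_weight_le:
  assumes p: "distinct p" "set p \<subseteq> {1..N}"
    and n: "n = Suc (length p) + k"
    and x: "x \<in> {1..N} - set p"
  shows "(\<Sum>z\<in>distinct_lists ({1..N} - set p - {x}) k.
            if x = Max (set (p @ x # z)) then weight n (Max (set (p @ x # z))) else 0)
         \<le> (if \<forall>y\<in>set p. y < x then real (Suc (length p)) / real n * weight (Suc (length p)) x else 0)"
    (is "sum ?f ?D \<le> ?R")
proof (cases "\<forall>y\<in>set p. y < x")
  case False
  then obtain y where y: "y \<in> set p" "x < y"
    using x by (metis DiffE linorder_neqE_nat)
  have "x \<noteq> Max (set (p @ x # z))" for z
  proof -
    have "y \<le> Max (set (p @ x # z))" using y(1) by (intro Max_ge) auto
    then show ?thesis using y(2) by simp
  qed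
  then have "sum ?f ?D = 0" by (intro sum.neutral) presburger
  then show ?thesis by (simp only: False if_False)
next
  case True
  let ?i = "length p"
  have less: "y < x" if "y \<in> set p" for y
    using True that by blast
  have sub: "set p \<subseteq> {1..<x}" using less p(2) by force
  have card: "card ({1..<x} - set p) = x - Suc ?i"
    using sub p(1) by (simp add: card_Diff_subset distinct_card)
  have ile: "Suc ?i \<le> x"
  proof -
    have "card (set p) \<le> card {1..<x}" by (rule card_mono[OF _ sub]) simp
    then have "?i \<le> x - 1" using distinct_card[OF p(1)] by simp
    moreover have "1 \<le> x" using x by simp
    ultimately show ?thesis by arith
  qed
  have sub2: "distinct_lists ({1..<x} - set p) k \<subseteq> ?D"
    using x by (fastforce simp: distinct_lists_def)
  have max: "x = Max (set (p @ x # z)) \<longleftrightarrow> (\<forall>y\<in>set z. y \<le> x)" for z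
  proof
    assume "x = Max (set (p @ x # z))"
    then show "\<forall>y\<in>set z. y \<le> x"
      by (metis List.finite_set Max_ge Un_iff list.set_intros(2) set_append)
  next
    assume "\<forall>y\<in>set z. y \<le> x"
    then show "x = Max (set (p @ x # z))"
      by (intro Max_eqI[symmetric]) (use less in \<open>auto simp: less_imp_le\<close>)
  qed
  have "sum ?f ?D = sum ?f (distinct_lists ({1..<x} - set p) k)"
  proof (rule sum.mono_neutral_right[OF _ sub2])
    show "finite ?D" by (intro finite_distinct_lists) simp
    show "\<forall>z\<in>?D - distinct_lists ({1..<x} - set p) k. ?f z = 0"
    proof
      fix z assume z: "z \<in> ?D - distinct_lists ({1..<x} - set p) k"
      then obtain y where "y \<in> set z" "\<not> y \<le> x"
        by (fastforce simp: distinct_lists_def)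
      then show "?f z = 0" using max[of z] by auto
    qed
  qed
  also have "\<dots> = (\<Sum>z\<in>distinct_lists ({1..<x} - set p) k. weight n x)"
  proof (intro sum.cong refl)
    fix z assume z: "z \<in> distinct_lists ({1..<x} - set p) k"
    have "x = Max (set (p @ x # z))"
      unfolding max using z by (auto simp: distinct_lists_def)
    then show "?f z = weight n x" by presburger
  qed
  also have "\<dots> = falling k (x - Suc ?i) * weight n x"
    by (simp only: sum_constant card_distinct_lists finite_Diff finite_atLeastLessThan card)
  \<comment> \<open>Equality holds for \<open>n \<le> x\<close>. For \<open>x < n\<close> the left
    side is 0, since \<open>weight n x\<close> is then a division by zero.\<close>
  also have "\<dots> \<le> real (Suc ?i) / real n * weight (Suc ?i) x"
  proof -
    have "falling n x = falling (Suc ?i) x * falling k (x - Suc ?i)"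
      unfolding n using falling_add[OF ile] .
    then show ?thesis
      unfolding weight_def by (simp add: divide_simps mult_less_0_iff leD[OF falling_nonneg])
  qed
  finally show ?thesis using True by simp
qed

text \<open>One decision of the dynamic program, with \<open>V\<close> as the induction hypothesis
  for rejecting. At a record the result is a convex combination of the accepting and rejecting
  payoffs, hence at most their maximum; at a non-record accepting earns nothing.\<close>

lemma gain_step_le:
  fixes a :: "nat list \<Rightarrow> real"
  assumes a: "\<And>xs. 0 \<le> a xs \<and> a xs \<le> 1"
    and p: "distinct p" "set p \<subseteq> {1..N}" "n = Suc (length p) + k"
    and x: "x \<in> {1..N} - set p" and v: "0 \<le> v"
    and V: "(\<Sum>z\<in>distinct_lists ({1..N} - set p - {x}) k.
        gain a (p @ [x]) (Max (set (p @ x # z))) z * weight n (Max (set (p @ x # z))))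
      \<le> v * weight (Suc (length p)) (Max (set (p @ [x])))"
  shows "(\<Sum>z\<in>distinct_lists ({1..N} - set p - {x}) k.
        gain a p (Max (set (p @ x # z))) (x # z) * weight n (Max (set (p @ x # z))))
      \<le> (if \<forall>y\<in>set p. y < x
          then max (real (Suc (length p)) / real n) v * weight (Suc (length p)) x
          else v * weight (Suc (length p)) (Max (set p)))" (is "?L \<le> ?R")
proof -
  let ?i = "length p" and ?b = "a (p @ [x])"
  let ?D = "distinct_lists ({1..N} - set p - {x}) k"
  let ?M = "\<lambda>z. Max (set (p @ x # z))"
  let ?q = "max (real (Suc ?i) / real n) v"
  define W where "W = (\<Sum>z\<in>?D. if x = ?M z then weight n (?M z) else 0)"
  define V' where "V' = (\<Sum>z\<in>?D. gain a (p @ [x]) (?M z) z * weight n (?M z))"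
  have "?L = ?b * W + (1 - ?b) * V'"
    unfolding W_def V'_def sum_distrib_left sum.distrib[symmetric]
    by (intro sum.cong) (simp_all add: algebra_simps)
  moreover have "?b * W \<le> ?b * (if \<forall>y\<in>set p. y < x then real (Suc ?i) / real n * weight (Suc ?i) x else 0)"
    unfolding W_def by (intro mult_left_mono win_weight_le p x) (use a in auto)
  moreover have "(1 - ?b) * V' \<le> (1 - ?b) * (v * weight (Suc ?i) (Max (set (p @ [x]))))"
    unfolding V'_def by (intro mult_left_mono V) (use a in auto)
  ultimately have le: "?L \<le> ?b * (if \<forall>y\<in>set p. y < x then real (Suc ?i) / real n * weight (Suc ?i) x else 0)
      + (1 - ?b) * (v * weight (Suc ?i) (Max (set (p @ [x]))))"
    by linarith
  show ?thesis
  proof (cases "\<forall>y\<in>set p. y < x")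
    case True
    have M: "Max (set (p @ [x])) = x"
      by (intro Max_eqI) (use True in \<open>auto simp: less_imp_le\<close>)
    have "?b * (real (Suc ?i) / real n * weight (Suc ?i) x) + (1 - ?b) * (v * weight (Suc ?i) x)
      \<le> ?b * (?q * weight (Suc ?i) x) + (1 - ?b) * (?q * weight (Suc ?i) x)"
      using a[of "p @ [x]"] weight_nonneg[of "Suc ?i" x]
      by (intro add_mono mult_left_mono mult_right_mono) auto
    also have "\<dots> = ?q * weight (Suc ?i) x" by (simp add: algebra_simps)
    finally show ?thesis using le True unfolding M by simp
  next
    case False
    then obtain y where y: "y \<in> set p" "x < y"
      using x by (metis DiffE linorder_neqE_nat)
    have "y \<le> Max (set p)" using y(1) by simp
    then have "x \<le> Max (set p)" using y(2) by simp
    then have M: "Max (set (p @ [x])) = Max (set p)"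
      using y by (subst set_append, subst Max_Un) (auto simp: max_def)
    have "(1 - ?b) * (v * weight (Suc ?i) (Max (set p))) \<le> 1 * (v * weight (Suc ?i) (Max (set p)))"
      using a[of "p @ [x]"] v weight_nonneg by (intro mult_right_mono) auto
    moreover have "?L \<le> (1 - ?b) * (v * weight (Suc ?i) (Max (set p)))"
      using le unfolding M by (simp only: False if_False mult_zero_right add_0_left)
    ultimately show ?thesis by (simp only: False if_False)
  qed
qed

text \<open>Backward induction on the number \<open>k\<close> of outstanding arrivals; it closes
  because the bound sees \<open>p\<close> only through its length and maximum. Hypothesis
  \<open>u_rec\<close> is the Bellman inequality multiplied by \<open>i + 1\<close>: the next
  arrival is a record with probability \<open>1 / (i + 1)\<close>, and a record at time
  \<open>i + 1\<close> wins with probability \<open>(i + 1) / n\<close>.\<close>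

lemma continuation_le:
  fixes a :: "nat list \<Rightarrow> real" and u :: "nat \<Rightarrow> real"
  assumes a: "\<And>xs. 0 \<le> a xs \<and> a xs \<le> 1"
    and u: "\<And>i. i \<le> n \<Longrightarrow> 0 \<le> u i"
    and u_rec: "\<And>i. i < n \<Longrightarrow>
       real i * u (Suc i) + max (real (Suc i) / real n) (u (Suc i)) \<le> real (Suc i) * u i"
    and p: "distinct p" "p \<noteq> []" "set p \<subseteq> {1..N}" "length p + k = n"
  shows "(\<Sum>z\<in>distinct_lists ({1..N} - set p) k.
            gain a p (Max (set (p @ z))) z * weight n (Max (set (p @ z))))
         \<le> u (length p) * weight (length p) (Max (set p))"
  using p
proof (induction k arbitrary: p)
  case 0
  then show ?case using u by (simp add: weight_nonneg)
next
  case (Suc k)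
  let ?A = "{1..N} - set p" and ?i = "length p" and ?m = "Max (set p)"
  let ?v = "u (Suc ?i)"
  let ?q = "max (real (Suc ?i) / real n) ?v"
  let ?M = "\<lambda>x z. Max (set (p @ x # z))"
  have i0: "0 < ?i" using Suc.prems by simp
  have v: "0 \<le> ?v" using u Suc.prems by simp
  have m: "?m \<in> set p" using Suc.prems by simp
  have mge: "y \<le> ?m" if "y \<in> set p" for y using that by simp
  have sub: "set p \<subseteq> {1..?m}" using Suc.prems by auto
  have im: "?i \<le> ?m"
    using card_mono[OF _ sub] Suc.prems by (simp add: distinct_card)
  have rec_iff: "(\<forall>y\<in>set p. y < x) \<longleftrightarrow> ?m < x" for x
    using m mge by (meson le_less_trans)
  have step: "(\<Sum>z\<in>distinct_lists (?A - {x}) k. gain a p (?M x z) (x # z) * weight n (?M x z))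
      \<le> (if ?m < x then ?q * weight (Suc ?i) x else ?v * weight (Suc ?i) ?m)"
    if x: "x \<in> ?A" for x
  proof -
    have "?A - {x} = {1..N} - set (p @ [x])" by auto
    then have "(\<Sum>z\<in>distinct_lists (?A - {x}) k. gain a (p @ [x]) (?M x z) z * weight n (?M x z))
        \<le> ?v * weight (Suc ?i) (Max (set (p @ [x])))"
      using Suc.IH[of "p @ [x]"] Suc.prems x by simp
    from gain_step_le[OF a _ _ _ x v this] show ?thesis
      unfolding rec_iff using Suc.prems by (simp only: add_Suc add_Suc_right simp_thms)
  qed
  have "(\<Sum>z\<in>distinct_lists ?A (Suc k). gain a p (Max (set (p @ z))) z * weight n (Max (set (p @ z))))
      = (\<Sum>x\<in>?A. \<Sum>z\<in>distinct_lists (?A - {x}) k. gain a p (?M x z) (x # z) * weight n (?M x z))"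
    by (rule sum_distinct_lists_Suc) simp
  also have "\<dots> \<le> (\<Sum>x\<in>?A. if ?m < x then ?q * weight (Suc ?i) x else ?v * weight (Suc ?i) ?m)"
    by (intro sum_mono step)
  \<comment> \<open>Unseen values split into the records above \<open>?m\<close> and the non-records
    below it.\<close>
  also have "\<dots> = (\<Sum>x\<in>{?m<..N}. ?q * weight (Suc ?i) x)
      + (\<Sum>x\<in>{1..<?m} - set p. ?v * weight (Suc ?i) ?m)"
  proof -
    have "{1..N} - S = {M<..N} \<union> ({1..<M} - S)"
      if "M \<in> S" "\<And>y. y \<in> S \<Longrightarrow> y \<le> M" "S \<subseteq> {1..N}" for M S
    proof -
      have "x \<in> {1..N} - S \<longleftrightarrow> x \<in> {M<..N} \<union> ({1..<M} - S)" for x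
        using that(1) that(2)[of x] subsetD[OF that(3,1)] by (cases x M rule: linorder_cases) auto
      then show ?thesis by blast
    qed
    then have "?A = {?m<..N} \<union> ({1..<?m} - set p)" using m mge Suc.prems(3) by blast
    then show ?thesis
      by (simp only:) (subst sum.union_disjoint, auto intro!: sum.cong)
  qed
  also have "(\<Sum>x\<in>{?m<..N}. ?q * weight (Suc ?i) x) \<le> ?q * (weight ?i ?m / (real ?i + 1))"
    unfolding sum_distrib_left[symmetric]
    by (intro mult_left_mono sum_weight_record_le i0 im) (simp add: le_max_iff_disj)
  also have "(\<Sum>x\<in>{1..<?m} - set p. ?v * weight (Suc ?i) ?m)
      \<le> ?v * (real ?i * weight ?i ?m / (real ?i + 1))"
  proof -
    have e: "{1..<?m} - set p = {1..?m} - set p" using m by (auto simp: le_less)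
    have "card ({1..<?m} - set p) = ?m - ?i"
      unfolding e using sub Suc.prems(1) by (simp add: card_Diff_subset distinct_card)
    moreover have "(real ?m - real ?i) * weight (Suc ?i) ?m \<le> real ?i * weight ?i ?m / (real ?i + 1)"
    \<comment> \<open>If \<open>?i = ?m\<close>, no smaller value is left and the factor
      \<open>?m - ?i\<close> vanishes. Otherwise it cancels the last factor of
      \<open>falling (Suc ?i) ?m\<close>.\<close>
    proof (cases "?i = ?m")
      case True
      then show ?thesis by (simp add: weight_nonneg)
    next
      case False
      then have "(real ?m - real ?i) * weight (Suc ?i) ?m = 1 / ((real ?i + 1) * falling ?i ?m)"
        by (simp add: weight_def falling_Suc add.commute)
      then show ?thesis using i0 by (simp add: weight_def mult.commute)
    qed
    ultimately have "(\<Sum>x\<in>{1..<?m} - set p. weight (Suc ?i) ?m) \<le> real ?i * weight ?i ?m / (real ?i + 1)"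
      using im by (simp only: sum_constant of_nat_diff)
    then show ?thesis
      unfolding sum_distrib_left[symmetric] by (rule mult_left_mono[OF _ v])
  qed
  also have "?q * (weight ?i ?m / (real ?i + 1)) + ?v * (real ?i * weight ?i ?m / (real ?i + 1))
      = (real ?i * ?v + ?q) / (real ?i + 1) * weight ?i ?m"
    by (simp add: add_divide_distrib algebra_simps)
  also have "\<dots> \<le> u ?i * weight ?i ?m"
    using u_rec[of ?i] Suc.prems by (intro mult_right_mono weight_nonneg)
      (simp add: divide_simps mult.commute add.commute)
  finally show ?case by simp
qed

text \<open>The first arrival is treated separately because the empty prefix has no maximum and
  \<open>weight 0 m\<close> is 0 by division by zero. Since \<open>weight 1 x\<close> is
  \<open>1 / x\<close>, summing over the first arrival produces \<open>harm N\<close>.\<close>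

lemma total_gain_le:
  fixes a :: "nat list \<Rightarrow> real" and u :: "nat \<Rightarrow> real"
  assumes a: "\<And>xs. 0 \<le> a xs \<and> a xs \<le> 1"
    and u: "\<And>i. i \<le> n \<Longrightarrow> 0 \<le> u i"
    and u_rec: "\<And>i. i < n \<Longrightarrow>
       real i * u (Suc i) + max (real (Suc i) / real n) (u (Suc i)) \<le> real (Suc i) * u i"
    and n: "0 < n"
  shows "(\<Sum>z\<in>distinct_lists {1..N} n. gain a [] (Max (set z)) z * weight n (Max (set z))) \<le> u 0 * harm N"
proof -
  obtain k where k: "n = Suc k" using n by (cases n) auto
  have "(\<Sum>z\<in>distinct_lists {1..N} n. gain a [] (Max (set z)) z * weight n (Max (set z)))
     = (\<Sum>x\<in>{1..N}. \<Sum>z\<in>distinct_lists ({1..N} - {x}) k.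
          gain a [] (Max (set (x # z))) (x # z) * weight n (Max (set (x # z))))"
    unfolding k by (rule sum_distinct_lists_Suc) simp
  also have "\<dots> \<le> (\<Sum>x\<in>{1..N}. max (1 / real n) (u 1) * weight 1 x)"
  proof (rule sum_mono)
    fix x assume x: "x \<in> {1..N}"
    have "(\<Sum>z\<in>distinct_lists ({1..N} - set [x]) k.
        gain a [x] (Max (set ([x] @ z))) z * weight n (Max (set ([x] @ z))))
        \<le> u (length [x]) * weight (length [x]) (Max (set [x]))"
      by (rule continuation_le[OF a u u_rec]) (use x k in auto)
    then show "(\<Sum>z\<in>distinct_lists ({1..N} - {x}) k.
          gain a [] (Max (set (x # z))) (x # z) * weight n (Max (set (x # z))))
        \<le> max (1 / real n) (u 1) * weight 1 x"
      using gain_step_le[OF a, of "[]" N n k x "u 1"] u[of 1] x k by simp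
  qed
  also have "\<dots> = max (1 / real n) (u 1) * harm N"
    unfolding sum_distrib_left[symmetric] by (simp add: harm_def weight_def falling_Suc inverse_eq_divide)
  also have "\<dots> \<le> u 0 * harm N"
    using u_rec[of 0] n by (intro mult_right_mono) (auto simp: harm_nonneg)
  finally show ?thesis .
qed

section \<open>An explicit supersolution of the classical secretary recursion\<close>

lemma ln_diff_ge:
  assumes "1 < (x::real)"
  shows "1 / x \<le> ln x - ln (x - 1)"
proof -
  have "ln ((x - 1) / x) \<le> (x - 1) / x - 1"
    using assms by (intro ln_le_minus_one) simp
  moreover have "ln ((x - 1) / x) = ln (x - 1) - ln x"
    using assms by (simp add: ln_div)
  moreover have "(x - 1) / x - 1 = - (1 / x)" using assms by (simp add: field_simps)
  ultimately show ?thesis by linarith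
qed

text \<open>The bound follows the continuous value function, which is $1/e$ up to time $1/e$ and $-x\ln x$
  afterwards; evaluating the logarithm at $i - 1$ instead of $i$ turns the discrete recursion into
  an instance of $\ln x - \ln (x - 1) \ge 1/x$.\<close>

lemma secretary_value_bound:
  assumes n: "0 < n"
  obtains u :: "nat \<Rightarrow> real" where
    "\<And>i. i \<le> n \<Longrightarrow> 0 \<le> u i"
    "\<And>i. i < n \<Longrightarrow>
       real i * u (Suc i) + max (real (Suc i) / real n) (u (Suc i)) \<le> real (Suc i) * u i"
    "u 0 \<le> 1 / exp 1 + 2 / real n"
proof -
  \<comment> \<open>The switching time is \<open>n / e\<close> rounded up. The constant phase has
    value \<open>(r + 1) / n\<close>, just enough to dominate accepting a record at any time up to
    \<open>r + 1\<close>; rounding and this extra 1 account for the error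
    \<open>2 / n\<close>.\<close>
  define r where "r = nat \<lceil>real n / exp 1\<rceil>"
  define L where "L j = ln (real n) - ln (real j - 1)" for j :: nat
  define u where "u j = (if j \<le> r then (real r + 1) / real n else real j / real n * L j)" for j
  have n': "0 < real n" using n by simp
  have r: "real n / exp 1 \<le> real r" "real r \<le> real n / exp 1 + 1"
    unfolding r_def using n' by (auto simp: of_nat_ceiling)
  have r0: "0 < real r" using r(1) n' by (meson divide_pos_pos exp_gt_zero less_le_trans)
  have L_le: "L j \<le> 1" if "r < j" for j
  proof -
    have "real n / exp 1 \<le> real j - 1" using r(1) that by linarith
    then have "ln (real n / exp 1) \<le> ln (real j - 1)"
      using n' by (intro ln_mono) simp_all
    then show ?thesis using n' by (simp add: L_def ln_div)
  qed
  have L_nonneg: "0 \<le> L j" if "r < j" "j \<le> n" for j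
    unfolding L_def using that r0 by simp
  have L_diff: "1 / (real j - 1) \<le> L (j - 1) - L j" if "Suc r < j" for j
  proof -
    have "real (j - 1) = real j - 1" using that by simp
    then show ?thesis
      unfolding L_def using ln_diff_ge[of "real j - 1"] that r0 by simp
  qed
  show thesis
  proof
    show "0 \<le> u i" if "i \<le> n" for i
      using L_nonneg[of i] that by (simp add: u_def)
    have "(real r + 1) / real n \<le> (real n / exp 1 + 2) / real n"
      using r(2) by (intro divide_right_mono) auto
    then show "u 0 \<le> 1 / exp 1 + 2 / real n"
      using n' by (simp add: u_def add_divide_distrib)
    fix i assume i: "i < n"
    consider "Suc i \<le> r" | "i = r" | "r < i" by linarith
    then show "real i * u (Suc i) + max (real (Suc i) / real n) (u (Suc i)) \<le> real (Suc i) * u i"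
    proof cases
      case 1
      then have "max (real (Suc i) / real n) ((real r + 1) / real n) = (real r + 1) / real n"
        using n' by (simp add: divide_right_mono)
      then show ?thesis using 1 by (simp add: u_def algebra_simps add_divide_distrib)
    next
      \<comment> \<open>At the switch, \<open>L (Suc r) \<le> 1\<close> keeps the logarithmic branch
        below the constant one.\<close>
      case 2
      have "u (Suc i) \<le> (real r + 1) / real n * 1"
        using mult_left_mono[OF L_le[of "Suc r"], of "(real r + 1) / real n"] n'
        by (simp add: u_def 2 add.commute)
      moreover have "u i = (real r + 1) / real n" by (simp add: u_def 2)
      moreover have "max (real (Suc i) / real n) (u (Suc i)) = (real r + 1) / real n"
        using calculation 2 by (simp add: add.commute max_def)
      ultimately show ?thesis
        using mult_left_mono[of "u (Suc i)" "u i" "real i"]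
        by (simp only: of_nat_Suc distrib_right mult_1_left) simp
    next
      \<comment> \<open>Each branch of the maximum is checked separately. Accepting reduces to
        \<open>i * (L i - L (Suc i)) \<ge> 1\<close>; rejecting needs \<open>u\<close> to decrease,
        which follows from the same inequality and \<open>L (Suc i) \<le> 1\<close>.\<close>
      case 3
      have d: "1 / real i \<le> L i - L (Suc i)" using L_diff[of "Suc i"] 3 by simp
      have i0: "0 < real i" using 3 by simp
      have d': "1 \<le> real i * (L i - L (Suc i))" using d i0 by (simp add: field_simps)
      have ui: "u i = real i * L i / real n" "u (Suc i) = (real i + 1) * L (Suc i) / real n"
        using 3 by (simp_all add: u_def add.commute)
      have "u (Suc i) \<le> u i"
        unfolding ui using L_le[of "Suc i"] d' 3 n'
        by (intro divide_right_mono) (auto simp: algebra_simps)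
      moreover have "real i * u (Suc i) + real (Suc i) / real n \<le> real (Suc i) * u i"
      proof -
        have "(real i + 1) * (real i * L (Suc i) + 1) \<le> (real i + 1) * (real i * L i)"
          using d' by (intro mult_left_mono) (auto simp: algebra_simps)
        then have "(real i + 1) * (real i * L (Suc i) + 1) / real n \<le> (real i + 1) * (real i * L i) / real n"
          using n' by (intro divide_right_mono) auto
        then show ?thesis unfolding ui by (simp add: algebra_simps add_divide_distrib)
      qed
      moreover have "real i * u (Suc i) + u (Suc i) \<le> real (Suc i) * u i"
        using mult_left_mono[OF \<open>u (Suc i) \<le> u i\<close>, of "real i + 1"] by (simp add: algebra_simps)
      ultimately show ?thesis by (simp add: max_def)
    qed
  qed
qed

section \<open>The instance distribution and its normalising constant\<close>

lemma finite_weighted_pmf: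
  fixes w :: "'a \<Rightarrow> real"
  assumes "finite F" "\<And>x. x \<in> F \<Longrightarrow> 0 \<le> w x" "0 < sum w F"
  obtains D :: "'a pmf" where "set_pmf D \<subseteq> F"
    "\<And>f :: 'a \<Rightarrow> real. measure_pmf.expectation D f = (\<Sum>x\<in>F. w x * f x) / sum w F"
proof
  define g where "g x = (if x \<in> F then w x / sum w F else 0)" for x
  have g: "0 \<le> g x" for x using assms by (simp add: g_def)
  have "(\<integral>\<^sup>+x. ennreal (g x) \<partial>count_space UNIV) = (\<Sum>x\<in>F. ennreal (g x))"
    by (rule nn_integral_count_space'[OF assms(1)]) (auto simp: g_def)
  also have "\<dots> = ennreal (\<Sum>x\<in>F. g x)" using g by simp
  also have "(\<Sum>x\<in>F. g x) = 1"
    using assms(3) by (simp add: g_def sum_divide_distrib[symmetric])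
  finally have one: "(\<integral>\<^sup>+x. ennreal (g x) \<partial>count_space UNIV) = 1" by simp
  show sub: "set_pmf (embed_pmf g) \<subseteq> F"
    by (auto simp: set_embed_pmf[OF g one] g_def split: if_splits)
  fix f :: "'a \<Rightarrow> real"
  have "measure_pmf.expectation (embed_pmf g) f = (\<Sum>x\<in>F. pmf (embed_pmf g) x *\<^sub>R f x)"
    by (rule integral_measure_pmf) (use assms sub in auto)
  then show "measure_pmf.expectation (embed_pmf g) f = (\<Sum>x\<in>F. w x * f x) / sum w F"
    by (simp add: pmf_embed_pmf[OF g one] g_def sum_divide_distrib)
qed

text \<open>Group the sets by their maximum \<open>M\<close>: there are
  \<open>(M - 1) choose (n - 1)\<close> of them, and together with the \<open>fact n\<close> arrival
  orders they contribute exactly \<open>1 / M\<close> when \<open>M \<ge> n\<close>. Keeping only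
  \<open>M > n\<close> gives the bound.\<close>

lemma harm_diff_le_sum_weight:
  assumes n: "0 < n"
  shows "harm N - harm n \<le> fact n * (\<Sum>K | K \<subseteq> {1..N} \<and> card K = n. weight n (Max K))"
proof -
  let ?F = "{K. K \<subseteq> {1..N} \<and> card K = n}"
  let ?T = "\<lambda>M. {T. T \<subseteq> {1..<M} \<and> card T = n - 1}"
  have "(\<Sum>K\<in>?F. weight n (Max K)) = (\<Sum>(M, T)\<in>(SIGMA M:{1..N}. ?T M). weight n M)"
  proof (rule sum.reindex_bij_witness[where j = "\<lambda>K. (Max K, K - {Max K})"
        and i = "\<lambda>(M, T). insert M T"])
    fix K assume K: "K \<in> ?F"
    then have "finite K" using finite_subset[of K "{1..N}"] by auto
    moreover have "K \<noteq> {}" using K n by auto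
    ultimately have M: "Max K \<in> K" "\<And>y. y \<in> K \<Longrightarrow> y \<le> Max K" by simp_all
    show "(case (Max K, K - {Max K}) of (M, T) \<Rightarrow> insert M T) = K"
      using M by auto
    show "(Max K, K - {Max K}) \<in> (SIGMA M:{1..N}. ?T M)"
      using M K by (force simp: le_less)
    show "(case (Max K, K - {Max K}) of (M, T) \<Rightarrow> weight n M) = weight n (Max K)" by simp
  next
    fix b assume "b \<in> (SIGMA M:{1..N}. ?T M)"
    then obtain M T where b: "b = (M, T)" "M \<in> {1..N}" "T \<subseteq> {1..<M}" "card T = n - 1" by auto
    have fin: "finite T" using b finite_subset by blast
    have M: "Max (insert M T) = M" by (rule Max_eqI) (use b fin in auto)
    have "M \<notin> T" using b by auto
    then show "(Max (case b of (M, T) \<Rightarrow> insert M T),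
      (case b of (M, T) \<Rightarrow> insert M T) - {Max (case b of (M, T) \<Rightarrow> insert M T)}) = b"
      using b M by auto
    show "(case b of (M, T) \<Rightarrow> insert M T) \<in> ?F"
      using b fin n \<open>M \<notin> T\<close> by (auto simp: card_insert_if)
  qed
  also have "\<dots> = (\<Sum>M\<in>{1..N}. \<Sum>T\<in>?T M. weight n M)"
    by (rule sum.Sigma[symmetric]) auto
  also have "\<dots> = (\<Sum>M\<in>{1..N}. real ((M - 1) choose (n - 1)) * weight n M)"
    by (simp add: n_subsets)
  finally have eq: "(\<Sum>K\<in>?F. weight n (Max K)) = (\<Sum>M\<in>{1..N}. real ((M - 1) choose (n - 1)) * weight n M)" .
  have "harm N - harm n \<le> (\<Sum>M\<in>{n<..N}. 1 / real M)"
  proof (cases "n \<le> N")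
    case True
    have "{1..N} = {1..n} \<union> {n<..N}" using n True by auto
    then have "harm N = harm n + (\<Sum>M\<in>{n<..N}. 1 / real M)"
      unfolding harm_def
      by (simp only: inverse_eq_divide) (intro sum.union_disjoint, auto)
    then show ?thesis by simp
  next
    case False
    then have "harm N \<le> (harm n :: real)" by (intro harm_mono) simp
    then show ?thesis using False by simp
  qed
  also have "\<dots> = (\<Sum>M\<in>{n<..N}. fact n * (real ((M - 1) choose (n - 1)) * weight n M))"
  proof (rule sum.cong[OF refl])
    fix M assume M: "M \<in> {n<..N}"
    have "real n * real (M choose n) = real M * real ((M - 1) choose (n - 1))"
      using times_binomial_minus1_eq[OF n, of M] by (metis of_nat_mult)
    moreover have "n - 1 \<le> M - 1" using M by (intro diff_le_mono) simp
    ultimately have "1 / real M = real ((M - 1) choose (n - 1)) / (real n * real (M choose n))"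
      using M n by (simp add: divide_simps mult.commute)
    then show "1 / real M = fact n * (real ((M - 1) choose (n - 1)) * weight n M)"
      by (simp add: weight_def falling_eq_binomial)
  qed
  also have "\<dots> \<le> (\<Sum>M\<in>{1..N}. fact n * (real ((M - 1) choose (n - 1)) * weight n M))"
    by (rule sum_mono2) (auto simp: weight_nonneg)
  finally show ?thesis unfolding eq by (simp add: sum_distrib_left)
qed

section \<open>Transfer from exponents to powers and from subsets to arrival orders\<close>

text \<open>A strictly increasing map preserves the position of the maximum, so an algorithm on real
  values can be pulled back to one on exponents.\<close>

lemma success_prob_map:
  assumes f: "strict_mono (f :: nat \<Rightarrow> real)"
  shows "success_prob a (map f ks) = gain (\<lambda>xs. a (map f xs)) [] (Max (set ks)) ks"
proof (cases "ks = []")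
  case False
  have "Max (f ` set ks) = f (Max (set ks))"
    using mono_Max_commute[of f "set ks"] strict_mono_mono[OF f] False by simp
  then show ?thesis
    unfolding gain_eq_sum success_prob_def accept_prob_def
    by (intro sum.cong) (auto simp: take_map strict_mono_eq[OF f])
qed (simp add: success_prob_def)

lemma instance_success_image:
  assumes f: "strict_mono (f :: nat \<Rightarrow> real)" and K: "finite K"
  shows "instance_success a (f ` K) =
    (\<Sum>ks\<in>permutations_of_set K. gain (\<lambda>xs. a (map f xs)) [] (Max K) ks) / fact (card K)"
proof -
  have inj_f: "inj f" using f by (rule strict_mono_imp_inj_on)
  then have inj: "inj_on f K" by (rule inj_on_subset) simp
  have inj_map: "inj_on (map f) (permutations_of_set K)"
    using inj_mapI[OF inj_f] by (rule inj_on_subset) simp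
  have "instance_success a (f ` K) =
      (\<Sum>xs\<in>permutations_of_set (f ` K). success_prob a xs) / fact (card K)"
    unfolding instance_success_def
    using K inj by (subst integral_pmf_of_set) (simp_all add: card_image)
  also have "(\<Sum>xs\<in>permutations_of_set (f ` K). success_prob a xs) =
      (\<Sum>ks\<in>permutations_of_set K. success_prob a (map f ks))"
    unfolding permutations_of_set_image_inj[OF inj] sum.reindex[OF inj_map] by simp
  also have "\<dots> = (\<Sum>ks\<in>permutations_of_set K. gain (\<lambda>xs. a (map f xs)) [] (Max K) ks)"
    by (intro sum.cong) (auto simp: success_prob_map[OF f] permutations_of_set_def)
  finally show ?thesis .
qed

text \<open>An \<open>n\<close>-subset together with an arrival order is the same thing as a
  repetition-free list of length \<open>n\<close>, the index set of the backward induction.\<close>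

lemma sum_subsets_permutations:
  fixes g :: "'a list \<Rightarrow> real"
  assumes "finite A"
  shows "(\<Sum>K | K \<subseteq> A \<and> card K = n. \<Sum>xs\<in>permutations_of_set K. g xs)
    = (\<Sum>xs\<in>distinct_lists A n. g xs)"
proof -
  have "(\<Sum>K | K \<subseteq> A \<and> card K = n. \<Sum>xs\<in>permutations_of_set K. g xs) =
      (\<Sum>xs\<in>(\<Union>K\<in>{K. K \<subseteq> A \<and> card K = n}. permutations_of_set K). g xs)"
  proof (rule sum.UNION_disjoint[symmetric])
    show "finite {K. K \<subseteq> A \<and> card K = n}" using assms by simp
  qed (auto dest: permutations_of_setD)
  also have "(\<Union>K\<in>{K. K \<subseteq> A \<and> card K = n}. permutations_of_set K) = distinct_lists A n"
    by (auto simp: permutations_of_set_def distinct_lists_def distinct_card)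
  finally show ?thesis .
qed

section \<open>Choice of parameters and the final estimate\<close>

theorem theorem5p6:
  fixes \<epsilon> \<rho> :: real
  assumes "\<epsilon> > 0" and "\<rho> > 1"
  shows "\<exists>(n::nat) (W::real set) (D::real set pmf).
           n > 0 \<and> finite W \<and> W \<subseteq> range (\<lambda>k::nat. \<rho> ^ k) \<and>
           set_pmf D \<subseteq> {S. S \<subseteq> W \<and> card S = n} \<and>
           (\<forall>a. valid_algorithm a \<longrightarrow>
              measure_pmf.expectation D (instance_success a) \<le> 1 / exp 1 + \<epsilon>)"
proof -
  define f where "f = (\<lambda>k::nat. \<rho> ^ k)"
  have f: "strict_mono f" unfolding f_def strict_mono_def using assms by simp
  \<comment> \<open>Half of \<open>\<epsilon>\<close> absorbs the discretisation error
    \<open>2 / n\<close>; the other half is reserved for the cutoff.\<close>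
  obtain n where n: "0 < n" "2 / real n < \<epsilon> / 2"
  proof -
    obtain n :: nat where n: "4 / \<epsilon> < real n" using reals_Archimedean2 by blast
    moreover have "0 < 4 / \<epsilon>" using assms by simp
    ultimately have "0 < real n" by linarith
    then show thesis using that[of n] n assms by (simp add: field_simps)
  qed
  obtain u where u: "\<And>i. i \<le> n \<Longrightarrow> 0 \<le> u i"
    "\<And>i. i < n \<Longrightarrow>
       real i * u (Suc i) + max (real (Suc i) / real n) (u (Suc i)) \<le> real (Suc i) * u i"
    "u 0 \<le> 1 / exp 1 + 2 / real n"
    using secretary_value_bound[OF n(1)] by blast
  let ?h = "\<lambda>N. harm N :: real"
  \<comment> \<open>Solves \<open>u 0 * harm n / c = \<epsilon> / 2\<close>, so a gap
    \<open>harm N - harm n\<close> of at least \<open>c\<close> makes the cutoff error small. The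
    additional 1 required of \<open>N\<close> keeps the gap positive even if
    \<open>c = 0\<close>.\<close>
  define c where "c = u 0 * ?h n * 2 / \<epsilon>"
  obtain N where N: "?h n + c + 1 \<le> ?h N"
    using harm_at_top unfolding filterlim_at_top eventually_sequentially by blast
  define F where "F = {K. K \<subseteq> {1..N} \<and> card K = n}"
  define Z where "Z = (\<Sum>K\<in>F. weight n (Max K))"
  have c0: "0 \<le> c" using u(1)[of 0] assms by (simp add: c_def harm_nonneg)
  have Z: "?h N - ?h n \<le> fact n * Z"
    unfolding Z_def F_def by (rule harm_diff_le_sum_weight[OF n(1)])
  then have "0 < fact n * Z" using N c0 by linarith
  then have Z0: "0 < Z" by (simp add: zero_less_mult_iff)
  have finF: "finite F" unfolding F_def by (rule finite_subset[of _ "Pow {1..N}"]) auto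
  obtain D where D: "set_pmf D \<subseteq> F"
    "\<And>g :: nat set \<Rightarrow> real. measure_pmf.expectation D g = (\<Sum>K\<in>F. weight n (Max K) * g K) / Z"
    using finite_weighted_pmf[OF finF, of "\<lambda>K. weight n (Max K)"] weight_nonneg Z0
    unfolding Z_def by blast
  have bound: "measure_pmf.expectation (map_pmf ((`) f) D) (instance_success a) \<le> 1 / exp 1 + \<epsilon>"
    if a: "valid_algorithm a" for a
  proof -
    let ?b = "\<lambda>xs. a (map f xs)"
    have b: "0 \<le> ?b xs \<and> ?b xs \<le> 1" for xs using a by (simp add: valid_algorithm_def)
    \<comment> \<open>The divisor \<open>fact n\<close> comes from the uniform arrival order; it
      later joins \<open>Z\<close> to form the product \<open>fact n * Z\<close> bounded below by
      \<open>harm N - harm n\<close>.\<close>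
    have "(\<Sum>K\<in>F. weight n (Max K) * instance_success a (f ` K)) =
        (\<Sum>K\<in>F. \<Sum>ks\<in>permutations_of_set K.
          gain ?b [] (Max (set ks)) ks * weight n (Max (set ks))) / fact n"
      unfolding sum_divide_distrib
    proof (rule sum.cong[OF refl])
      fix K assume K: "K \<in> F"
      then have "finite K" "card K = n" using finite_subset[of K "{1..N}"] by (auto simp: F_def)
      then have "weight n (Max K) * instance_success a (f ` K) =
          (\<Sum>ks\<in>permutations_of_set K. gain ?b [] (Max K) ks * weight n (Max K)) / fact n"
        by (simp add: instance_success_image[OF f] sum_distrib_left mult.commute)
      also have "\<dots> = (\<Sum>ks\<in>permutations_of_set K.
          gain ?b [] (Max (set ks)) ks * weight n (Max (set ks))) / fact n"
        by (intro arg_cong[where f = "\<lambda>x. x / fact n"] sum.cong) (auto simp: permutations_of_set_def)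
      finally show "weight n (Max K) * instance_success a (f ` K) =
          (\<Sum>ks\<in>permutations_of_set K. gain ?b [] (Max (set ks)) ks * weight n (Max (set ks)) / fact n)"
        by (simp add: sum_divide_distrib)
    qed
    also have "\<dots> \<le> u 0 * ?h N / fact n"
      unfolding F_def sum_subsets_permutations[OF finite_atLeastAtMost]
      by (intro divide_right_mono total_gain_le b u n) auto
    finally have le: "(\<Sum>K\<in>F. weight n (Max K) * instance_success a (f ` K)) \<le> u 0 * ?h N / fact n" .
    have "measure_pmf.expectation (map_pmf ((`) f) D) (instance_success a) =
        (\<Sum>K\<in>F. weight n (Max K) * instance_success a (f ` K)) / Z"
      by (simp add: D(2))
    also have "\<dots> \<le> u 0 * ?h N / fact n / Z"
      using le Z0 by (intro divide_right_mono) auto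
    also have "\<dots> = u 0 * ?h N / (fact n * Z)" by simp
    also have "\<dots> \<le> u 0 * ?h N / (?h N - ?h n)"
      using Z N c0 u(1)[of 0] by (intro divide_left_mono) (auto simp: harm_nonneg)
    also have "\<dots> = u 0 + u 0 * ?h n / (?h N - ?h n)"
      using N c0 by (simp add: field_simps)
    also have "u 0 * ?h n / (?h N - ?h n) \<le> \<epsilon> / 2"
    proof -
      have "u 0 * ?h n = \<epsilon> / 2 * c" using assms by (simp add: c_def)
      also have "\<dots> \<le> \<epsilon> / 2 * (?h N - ?h n)"
        using N assms by (intro mult_left_mono) auto
      finally show ?thesis using N c0 by (simp add: pos_divide_le_eq)
    qed
    finally show ?thesis using u(3) n(2) by linarith
  qed
  have "inj f" using f by (rule strict_mono_imp_inj_on)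
  then have card: "card (f ` K) = card K" for K
    by (intro card_image) (rule inj_on_subset[OF _ subset_UNIV])
  have "set_pmf (map_pmf ((`) f) D) \<subseteq> {S. S \<subseteq> f ` {1..N} \<and> card S = n}"
  proof
    fix S assume "S \<in> set_pmf (map_pmf ((`) f) D)"
    then obtain K where "K \<in> F" "S = f ` K" using D(1) by (auto simp only: set_map_pmf)
    then show "S \<in> {S. S \<subseteq> f ` {1..N} \<and> card S = n}"
      by (simp add: F_def card image_mono)
  qed
  moreover have "f ` {1..N} \<subseteq> range (\<lambda>k::nat. \<rho> ^ k)" unfolding f_def by (rule image_mono) simp
  ultimately show ?thesis
    by (intro exI[of _ n] exI[of _ "f ` {1..N}"] exI[of _ "map_pmf ((`) f) D"] conjI allI impI
        n(1) finite_imageI finite_atLeastAtMost bound)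
qed

end
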